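(* Let $A$ be an ordered alphabet. The concatenation of finitely many Ferrers final segments of $A^{\ast}$ is a Ferrers final segment of $A^{\ast}$.
   Context: $A$ is a partially ordered set. $A^{\ast}$ is the free monoid of words over $A$, ordered by the Higman ordering: $a_0\cdots a_{n-1}\le b_0\cdots b_{m-1}$ iff there is a strictly increasing map $h:\{0,\dots,n-1\}\to\{0,\dots,m-1\}$ with $a_i\le b_{h(i)}$ for all $i$. A final segment is an upward closed subset. The concatenation of $X,Y\subseteq A^{\ast}$ is $XY=\{uv:u\in X,v\in Y\}$. A language $L\subseteq A^{\ast}$ is Ferrers if for all $x,x',y,y'\in A^{\ast}$: $xx'\in L$ and $yy'\in L$ imply $xy'\in L$ or $yx'\in L$. *)

theory Defs
  imports Main "HOL-Library.Sublist"
begin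

text \<open>
  The alphabet is a carrier set \<open>A\<close> (possibly empty) with a partial order
  \<open>r \<subseteq> A \<times> A\<close>, where \<open>(a, b) \<in> r\<close> reads \<open>a \<le> b\<close>;
  the free monoid over \<open>A\<close> is \<open>lists A\<close>.
\<close>

definition higman_le :: "'a rel \<Rightarrow> 'a list \<Rightarrow> 'a list \<Rightarrow> bool" where
  "higman_le r = list_emb (\<lambda>a b. (a, b) \<in> r)"

lemma list_emb_iff_strict_mono:
  "list_emb P u v \<longleftrightarrow>
    (\<exists>h. strict_mono_on {..<length u} h \<and>
         (\<forall>i<length u. h i < length v \<and> P (u ! i) (v ! h i)))"
  (is "_ \<longleftrightarrow> (\<exists>h. ?E u v h)")
proof
  show "\<exists>h. ?E u v h" if "list_emb P u v"
    using that
  proof induction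
    case (list_emb_Nil ys)
    show ?case by (auto simp: strict_mono_on_def)
  next
    case (list_emb_Cons xs ys y)
    then obtain h where "?E xs ys h" by blast
    then have "?E xs (y # ys) (\<lambda>i. Suc (h i))" by (auto simp: strict_mono_on_def)
    then show ?case by blast
  next
    case (list_emb_Cons2 x y xs ys)
    then obtain h where "?E xs ys h" by blast
    then have "?E (x # xs) (y # ys) (case_nat 0 (\<lambda>i. Suc (h i)))"
      using list_emb_Cons2.hyps
      by (auto simp: strict_mono_on_def less_Suc_eq_0_disj split: nat.splits)
    then show ?case by blast
  qed
next
  have "list_emb P u v" if "?E u v h" for h
    using that
  proof (induction u arbitrary: v h)
    case Nil
    show ?case by simp
  next
    case (Cons x xs)
    let ?k = "h 0"
    let ?w = "drop (Suc ?k) v"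
    have k: "?k < length v" "P x (v ! ?k)"
      using Cons.prems by (auto dest!: conjunct2 spec[where x = 0])
    have h: "?k < h (Suc i)" "h (Suc i) < length v" "P (xs ! i) (v ! h (Suc i))"
      if "i < length xs" for i
      using Cons.prems that by (auto simp: strict_mono_on_def)
    have mono: "h (Suc i) < h (Suc j)" if "i < j" "j < length xs" for i j
      using Cons.prems that by (auto simp: strict_mono_on_def)
    have "h (Suc i) - Suc ?k < h (Suc j) - Suc ?k" if "i < j" "j < length xs" for i j
      using mono[OF that] h(1)[of i] that by linarith
    moreover have "h (Suc i) - Suc ?k < length ?w \<and> P (xs ! i) (?w ! (h (Suc i) - Suc ?k))"
      if "i < length xs" for i
      using h[OF that] by simp
    ultimately have "?E xs ?w (\<lambda>i. h (Suc i) - Suc ?k)"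
      by (auto simp: strict_mono_on_def)
    then have "list_emb P xs ?w" by (rule Cons.IH)
    then have "list_emb P (x # xs) (take ?k v @ v ! ?k # ?w)"
      using k(2) by (intro list_emb_append2 list_emb_Cons2)
    then show ?case using k(1) by (simp add: id_take_nth_drop[symmetric])
  qed
  then show "list_emb P u v" if "\<exists>h. ?E u v h" using that by blast
qed

definition final_segment :: "'a set \<Rightarrow> 'a rel \<Rightarrow> 'a list set \<Rightarrow> bool" where
  "final_segment A r L \<longleftrightarrow>
    L \<subseteq> lists A \<and> (\<forall>u\<in>L. \<forall>v\<in>lists A. higman_le r u v \<longrightarrow> v \<in> L)"

definition ferrers :: "'a set \<Rightarrow> 'a list set \<Rightarrow> bool" where
  "ferrers A L \<longleftrightarrow>
    L \<subseteq> lists A \<and>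
    (\<forall>x\<in>lists A. \<forall>x'\<in>lists A. \<forall>y\<in>lists A. \<forall>y'\<in>lists A.
      x @ x' \<in> L \<longrightarrow> y @ y' \<in> L \<longrightarrow> x @ y' \<in> L \<or> y @ x' \<in> L)"

definition conc :: "'a list set \<Rightarrow> 'a list set \<Rightarrow> 'a list set" where
  "conc X Y = {u @ v |u v. u \<in> X \<and> v \<in> Y}"

definition conc_list :: "'a list set list \<Rightarrow> 'a list set" where
  "conc_list Ls = foldr conc Ls {[]}"

end

theory Submission
  imports Defs
begin

lemma conc_subset_lists:
  assumes "X \<subseteq> lists A" and "Y \<subseteq> lists A"
  shows "conc X Y \<subseteq> lists A"
proof
  fix w assume "w \<in> conc X Y"
  then obtain u v where "w = u @ v" "u \<in> X" "v \<in> Y"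
    by (auto simp: conc_def)
  with assms show "w \<in> lists A"
    by (simp add: subset_iff del: in_lists_conv_set)
qed

text \<open>An embedding of \<open>s @ t\<close> into \<open>v\<close> cuts \<open>v\<close> into a
  part receiving \<open>s\<close> and a part receiving \<open>t\<close>, so each factor can be
  enlarged separately.\<close>

lemma final_segment_conc:
  assumes "final_segment A r X" and "final_segment A r Y"
  shows "final_segment A r (conc X Y)"
  unfolding final_segment_def
proof (intro conjI ballI impI)
  show "conc X Y \<subseteq> lists A"
    using assms by (simp add: final_segment_def conc_subset_lists)
next
  fix u v assume u: "u \<in> conc X Y" and v: "v \<in> lists A" and uv: "higman_le r u v"
  from u obtain s t where st: "u = s @ t" "s \<in> X" "t \<in> Y"
    by (auto simp: conc_def)
  from uv obtain s' t' where v': "v = s' @ t'" and emb: "higman_le r s s'" "higman_le r t t'"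
    unfolding higman_le_def st(1) by (blast dest: list_emb_appendD)
  have "s' \<in> lists A" "t' \<in> lists A"
    using v v' by simp_all
  then have "s' \<in> X" "t' \<in> Y"
    using st emb assms unfolding final_segment_def by blast+
  then show "v \<in> conc X Y"
    using v' unfolding conc_def by blast
qed

text \<open>Reflexivity of \<open>r\<close> embeds \<open>t\<close> into itself, and the embedding
  skips the letters of \<open>w\<close>. This absorbs the surplus letters when tails are
  exchanged.\<close>

lemma final_segment_append_left:
  assumes "refl_on A r" and "final_segment A r L" and "t \<in> L" and "w \<in> lists A"
  shows "w @ t \<in> L"
proof -
  have t: "t \<in> lists A" using assms(2,3) by (auto simp: final_segment_def)
  then have "list_emb (\<lambda>a b. (a, b) \<in> r) t t"
    using assms(1) by (intro list_emb_refl) (auto dest: refl_onD)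
  then have "higman_le r t (w @ t)"
    unfolding higman_le_def by (rule list_emb_append2)
  then show ?thesis
    using assms t by (auto simp: final_segment_def)
qed

text \<open>
  Given factorizations of \<open>x @ x'\<close> and \<open>y @ y'\<close>, compare their cutting points with those after
  \<open>x\<close> and \<open>y\<close>. If both lie on the same side, one of the factors \<open>X\<close>, \<open>Y\<close> being Ferrers
  settles the claim; otherwise exchanging the tails only enlarges the word
  available to \<open>Y\<close>.
\<close>

lemma ferrers_conc:
  assumes r: "refl_on A r" and Y: "final_segment A r Y"
    and fX: "ferrers A X" and fY: "ferrers A Y"
  shows "ferrers A (conc X Y)"
  unfolding ferrers_def
proof (intro conjI ballI impI)
  show "conc X Y \<subseteq> lists A"
    using fX fY by (simp add: ferrers_def conc_subset_lists)
next
  fix x x' y y'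
  assume l: "x \<in> lists A" "x' \<in> lists A" "y \<in> lists A" "y' \<in> lists A"
    and "x @ x' \<in> conc X Y" "y @ y' \<in> conc X Y"
  then obtain u v s t where uv: "x @ x' = u @ v" "u \<in> X" "v \<in> Y"
    and st: "y @ y' = s @ t" "s \<in> X" "t \<in> Y"
    by (auto simp: conc_def)
  have concI: "a @ b \<in> conc X Y" if "a \<in> X" "b \<in> Y" for a b
    using that by (auto simp: conc_def)
  \<comment> \<open>Two prefixes of one word are comparable; \<open>w\<close> is the stretch between
    the two cuts.\<close>
  from uv(1) consider w where "x = u @ w" "v = w @ x'" | w where "u = x @ w" "x' = w @ v"
    by (auto simp: append_eq_append_conv2)
  note cut_x = this
  from st(1) consider z where "y = s @ z" "t = z @ y'" | z where "s = y @ z" "y' = z @ t"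
    by (auto simp: append_eq_append_conv2)
  note cut_y = this
  show "x @ y' \<in> conc X Y \<or> y @ x' \<in> conc X Y"
  proof (cases rule: cut_x)
    case w: (1 w)
    show ?thesis
    proof (cases rule: cut_y)
      case z: (1 z)
      have "w @ y' \<in> Y \<or> z @ x' \<in> Y"
        using fY uv(3) st(3) w z l by (simp add: ferrers_def)
      then show ?thesis
        using concI uv(2) st(2) w(1) z(1) by auto
    next
      case z: (2 z)
      \<comment> \<open>Here \<open>x @ y' = u @ (w @ z) @ t\<close>, so the first alternative holds
        outright.\<close>
      have "(w @ z) @ t \<in> Y"
        using l w z st(3) by (intro final_segment_append_left[OF r Y]) auto
      then show ?thesis
        using concI[OF uv(2)] w(1) z(2) by auto
    qed
  next
    case w: (2 w)
    show ?thesis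
    proof (cases rule: cut_y)
      case z: (1 z)
      \<comment> \<open>Symmetrically, \<open>y @ x' = s @ (z @ w) @ v\<close> gives the second
        alternative.\<close>
      have "(z @ w) @ v \<in> Y"
        using l w z uv(3) by (intro final_segment_append_left[OF r Y]) auto
      then show ?thesis
        using concI[OF st(2)] w(2) z(1) by auto
    next
      case z: (2 z)
      have "x @ z \<in> X \<or> y @ w \<in> X"
        using fX uv(2) st(2) w z l by (simp add: ferrers_def)
      then show ?thesis
        using concI[OF _ uv(3), of "y @ w"] concI[OF _ st(3), of "x @ z"] w(2) z(2) by auto
    qed
  qed
qed

theorem corollary19:
  fixes A :: "'a set" and r :: "'a rel" and Ls :: "'a list set list"
  assumes "partial_order_on A r"
    and "Ls \<noteq> []"
    and "\<And>L. L \<in> set Ls \<Longrightarrow> final_segment A r L \<and> ferrers A L"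
  shows "final_segment A r (conc_list Ls) \<and> ferrers A (conc_list Ls)"
  using assms(2,3)
\<comment> \<open>The induction starts at one factor because the empty product \<open>{[]}\<close>
  is not a final segment when \<open>A\<close> is nonempty.\<close>
proof (induction Ls rule: list_nonempty_induct)
  case (single L)
  then show ?case by (simp add: conc_list_def conc_def)
next
  case (cons L Ls)
  have "refl_on A r"
    using assms(1) by (simp add: partial_order_on_def preorder_on_def)
  moreover have "conc_list (L # Ls) = conc L (conc_list Ls)"
    by (simp add: conc_list_def)
  ultimately show ?case
    \<comment> \<open>Both properties travel together: \<open>ferrers_conc\<close> asks that the
      tail product be a final segment.\<close>
    using cons by (simp add: final_segment_conc ferrers_conc)
qed

end
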